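(* For every positive integer $n>4$ there is a prime number $p$ with $6n<p<7n$. *)

theory Defs
  imports "HOL-Computational_Algebra.Primes"
begin

end

theory Submission
  imports Defs "HOL-Number_Theory.Prime_Powers" "HOL-Analysis.Harmonic_Numbers"
begin

text \<open>
  A Chebyshev-type argument. With \<open>x = 42 n\<close>, consider \<open>\<Sum>c\<^sub>e ln \<lfloor>x / e\<rfloor>!\<close> for integers \<open>c\<^sub>e\<close>,
  indexed by divisors \<open>e \<ge> 6\<close> of 1260, such that \<open>\<Sum>c\<^sub>e / e = 0\<close>. It equals
  \<open>\<Sum>\<Lambda>(m) W(\<lfloor>x / m\<rfloor>)\<close> with the 1260-periodic weight \<open>W(k) = \<Sum>c\<^sub>e \<lfloor>k / e\<rfloor>\<close>. The
  coefficients are chosen so that \<open>W(6) = 1\<close> while \<open>W(k) \<le> 0\<close> for all other \<open>k < 1260\<close>. As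
  \<open>\<lfloor>x / m\<rfloor> = 6\<close> means \<open>6 n < m \<le> 7 n\<close>, only this interval and the tail \<open>m \<le> n / 30\<close>, for which
  a crude bound suffices, contribute positively. Stirling's formula shows that the whole sum
  is at least a multiple of \<open>n\<close> exceeding the tail and the proper prime powers once \<open>n \<ge> 2\<^sup>1\<^sup>5\<close>;
  a chain of explicit primes covers the smaller \<open>n\<close>.
\<close>

section \<open>Factorials and the von Mangoldt function\<close>

text \<open>Passing from \<open>n\<close> to \<open>Suc n\<close> raises \<open>n div m\<close> by
  one exactly at the divisors \<open>m\<close> of \<open>Suc n\<close>, and \<open>mangoldt\<close>
  summed over these gives \<open>ln (Suc n)\<close>.\<close>

lemma ln_fact_conv_mangoldt:
  "ln (fact n :: real) = (\<Sum>m=1..n. mangoldt m * real (n div m))"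
proof (induction n)
  case (Suc n)
  have "(\<Sum>m=1..Suc n. mangoldt m * real (Suc n div m)) =
      (\<Sum>m=1..Suc n. mangoldt m * real (n div m)) +
      (\<Sum>m=1..Suc n. if m dvd Suc n then mangoldt m else 0)"
    unfolding sum.distrib [symmetric]
    by (intro sum.cong) (auto simp: div_Suc dvd_eq_mod_eq_0 algebra_simps)
  also have "(\<Sum>m=1..Suc n. if m dvd Suc n then mangoldt m else 0) =
      (\<Sum>m | m dvd Suc n. mangoldt m :: real)"
    by (intro sum.mono_neutral_cong_right) (use dvd_pos_nat[of "Suc n"] in \<open>auto dest: dvd_imp_le simp: Suc_le_eq\<close>)
  also have "\<dots> = ln (real (Suc n))"
    using mangoldt_sum[of "Suc n", where 'a = real] by simp
  also have "(\<Sum>m=1..Suc n. mangoldt m * real (n div m)) =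
      (\<Sum>m=1..n. mangoldt m * real (n div m))"
    by simp
  finally show ?case
    using Suc.IH by (simp add: ln_mult)
qed simp

text \<open>Iterated floor divisions commute. The range runs up to \<open>x\<close> rather than
  \<open>x div e\<close>, the extra terms being zero, so that sums for different \<open>e\<close>
  can be combined termwise.\<close>

lemma ln_fact_div_conv_mangoldt:
  "ln (fact (x div e) :: real) = (\<Sum>m=1..x. mangoldt m * real (x div m div e))"
proof -
  have "(\<Sum>m=1..x. mangoldt m * real (x div m div e)) =
      (\<Sum>m=1..x. mangoldt m * real (x div e div m))"
    by (intro sum.cong refl) (metis div_mult2_eq mult.commute)
  also have "\<dots> = (\<Sum>m=1..x div e. mangoldt m * real (x div e div m))"
    by (intro sum.mono_neutral_right)
       (use div_le_dividend[of x e] in \<open>auto simp: not_le intro: order_trans\<close>)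
  finally show ?thesis by (simp add: ln_fact_conv_mangoldt)
qed

definition div_weight :: "(nat \<times> int) list \<Rightarrow> nat \<Rightarrow> int" where
  "div_weight cs k = (\<Sum>(e, c)\<leftarrow>cs. c * int (k div e))"

lemma sum_ln_fact_conv_div_weight:
  "(\<Sum>(e, c)\<leftarrow>cs. of_int c * ln (fact (x div e))) =
    (\<Sum>m=1..x. mangoldt m * real_of_int (div_weight cs (x div m)))"
proof (induction cs)
  case (Cons ec cs)
  obtain e c where "ec = (e, c)" by fastforce
  with Cons show ?case
    by (simp add: div_weight_def ln_fact_div_conv_mangoldt algebra_simps sum.distrib
        sum_distrib_left del: of_nat_div)
qed (simp add: div_weight_def)

text \<open>Since every \<open>e\<close> divides \<open>L\<close>, adding \<open>L * q\<close> to
  the argument adds \<open>q\<close> times the weight at \<open>L\<close>. The second assumption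
  says that this weight is 0; it is \<open>L\<close> times the condition that the
  \<open>c / e\<close> sum to zero.\<close>

lemma div_weight_periodic:
  assumes "\<forall>(e, c)\<in>set cs. e dvd L \<and> e > 0" and "(\<Sum>(e, c)\<leftarrow>cs. c * int (L div e)) = 0"
  shows "div_weight cs (k mod L) = div_weight cs k"
proof -
  have "div_weight cs (L * q + r) = int q * (\<Sum>(e, c)\<leftarrow>cs. c * int (L div e)) + div_weight cs r"
    for q r
    using assms(1)
  proof (induction cs)
    case (Cons ec cs)
    obtain e c where ec: "ec = (e, c)" by fastforce
    then obtain d where "L = e * d" "e > 0" using Cons.prems by auto
    hence "(L * q + r) div e = (L div e) * q + r div e"
      by (simp add: mult.assoc)
    with Cons ec show ?case
      by (simp add: div_weight_def algebra_simps del: of_nat_div)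
  qed (simp add: div_weight_def)
  from this[of "k div L" "k mod L"] show ?thesis
    using assms(2) by simp
qed

section \<open>Stirling bounds\<close>

lemma ln_fact_Suc: "ln (fact (Suc n) :: real) = ln (real (Suc n)) + ln (fact n)"
  by (subst fact_Suc, subst ln_mult) simp_all

text \<open>The increments are compared through ln (1 + 1/k) \<le> 1/k; the upper bound below uses
  ln (1 + 1/k) \<ge> 1/(k + 1) in the same way.\<close>

lemma ln_fact_ge:
  assumes "n \<ge> 1"
  shows "real n * ln n - n + 1 \<le> ln (fact n)"
  using assms
proof (induction n rule: dec_induct)
  case (step k)
  have "ln (real (Suc k) / k) \<le> real (Suc k) / k - 1"
    using step by (intro ln_le_minus_one) auto
  hence "real k * (ln (real (Suc k)) - ln k) \<le> 1"
    using step by (simp add: ln_div field_simps)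
  with step.IH show ?case unfolding ln_fact_Suc by (simp add: algebra_simps)
qed simp

lemma ln_fact_le:
  assumes "n \<ge> 1"
  shows "ln (fact n) \<le> (real n + 1) * ln n - n + 1"
  using assms
proof (induction n rule: dec_induct)
  case (step k)
  have "ln (real k / Suc k) \<le> real k / Suc k - 1"
    using step by (intro ln_le_minus_one) auto
  hence "real (Suc k) * (ln (real (Suc k)) - ln k) \<ge> 1"
    using step by (simp add: ln_div field_simps)
  with step.IH show ?case unfolding ln_fact_Suc by (simp add: algebra_simps)
qed simp

lemma mult_ln_minus_self_mono:
  fixes a b :: real
  assumes "1 \<le> a" "a \<le> b"
  shows "a * ln a - a \<le> b * ln b - b"
proof -
  have "ln (a / b) \<le> a / b - 1" "ln (1 / b) \<le> 1 / b - 1"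
    using assms by (intro ln_le_minus_one; simp)+
  hence a: "ln a \<le> ln b - (b - a) / b" and b: "ln b \<ge> 1 - 1 / b"
    using assms by (auto simp: ln_div field_simps)
  have "a * ln a \<le> a * (ln b - (b - a) / b)"
    using a assms by (intro mult_left_mono) auto
  moreover have "(b - a) * 1 \<le> (b - a) * (ln b + a / b)"
  proof (intro mult_left_mono)
    have "a / b \<ge> 1 / b" using assms by (intro divide_right_mono) auto
    thus "1 \<le> ln b + a / b" using b by simp
  qed (use assms in auto)
  ultimately show ?thesis using assms by (simp add: algebra_simps)
qed

lemma ln_fact_div_approx:
  assumes "e > 0" "e \<le> x"
  shows "\<bar>ln (fact (x div e)) - real x / e * (ln (real x / e) - 1)\<bar> \<le> ln (real x / e) + 1"
proof -
  define n where "n = x div e"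
  define y where "y = real x / e"
  have n: "n \<ge> 1" using assms by (simp add: n_def div_greater_zero_iff Suc_le_eq)
  have y: "y \<ge> 1" using assms by (simp add: y_def)
  have ny: "real n \<le> y"
    unfolding n_def y_def by (rule of_nat_div_le_of_nat)
  have yn: "y \<le> real (Suc n)"
  proof -
    have "x < e * Suc n" using dividend_less_times_div[of e x] assms by (simp add: n_def)
    hence "real x < real e * real (Suc n)" by (metis of_nat_less_iff of_nat_mult)
    thus ?thesis using assms by (simp add: y_def field_simps)
  qed
  have "ln (fact n) \<le> (real n * ln n - n) + ln n + 1"
    using ln_fact_le[OF n] by (simp add: algebra_simps)
  also have "\<dots> \<le> (y * ln y - y) + ln y + 1"
  proof -
    have "ln n \<le> ln y" using n ny by (subst ln_le_cancel_iff) auto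
    with mult_ln_minus_self_mono[of "real n" y] n ny show ?thesis by linarith
  qed
  finally have upper: "ln (fact n) \<le> y * (ln y - 1) + (ln y + 1)"
    by (simp add: algebra_simps)
  \<comment> \<open>For the lower bound, monotonicity is applied to \<open>Suc n\<close>, the
    integer above \<open>y\<close>; removing the factor \<open>Suc n\<close> from its factorial
    costs at most \<open>1 + ln y\<close>.\<close>
  have "ln (real (Suc n)) \<le> ln (2 * y)"
    using n ny by (subst ln_le_cancel_iff) auto
  also have "\<dots> \<le> 1 + ln y"
    using y ln_le_minus_one[of 2] by (simp add: ln_mult)
  finally have "ln (real (Suc n)) \<le> 1 + ln y" .
  moreover have "real (Suc n) * ln (real (Suc n)) - Suc n + 1 \<le> ln (fact (Suc n))"
    by (rule ln_fact_ge) simp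
  moreover have "y * ln y - y \<le> real (Suc n) * ln (real (Suc n)) - Suc n"
    using y yn by (rule mult_ln_minus_self_mono)
  moreover have "ln (fact (Suc n) :: real) = ln (real (Suc n)) + ln (fact n)"
    by (rule ln_fact_Suc)
  ultimately have "ln (fact n) \<ge> y * (ln y - 1) - (ln y + 1)"
    by (simp add: algebra_simps)
  with upper show ?thesis unfolding n_def y_def by (simp add: abs_le_iff)
qed

text \<open>Splitting \<open>ln (x / e)\<close> as \<open>ln x - ln e\<close> isolates the x ln x
  term, which disappears once the \<open>c / e\<close> sum to zero. The bound \<open>b\<close> on
  the indices makes the error uniform in \<open>e\<close>.\<close>

lemma sum_ln_fact_ge:
  fixes b x :: nat
  assumes "\<forall>(e, c)\<in>set cs. b \<le> e \<and> e \<le> x" "b > 0" "x > 0"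
  shows "(\<Sum>(e, c)\<leftarrow>cs. of_int c * ln (fact (x div e))) \<ge>
    x * (ln x - 1) * (\<Sum>(e, c)\<leftarrow>cs. of_int c / real e)
    - x * (\<Sum>(e, c)\<leftarrow>cs. of_int c * ln (real e) / real e)
    - (\<Sum>(e, c)\<leftarrow>cs. of_int \<bar>c\<bar>) * (ln (real x / b) + 1)"
  using assms(1)
proof (induction cs)
  case (Cons ec cs)
  obtain e c where ec: "ec = (e, c)" by fastforce
  with Cons.prems have e: "b \<le> e" "e \<le> x" by auto
  let ?d = "ln (fact (x div e)) - real x / e * (ln (real x / e) - 1)"
  have "\<bar>?d\<bar> \<le> ln (real x / e) + 1"
    using e assms(2) by (intro ln_fact_div_approx) auto
  also have "ln (real x / e) \<le> ln (real x / b)"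
    using e assms by (subst ln_le_cancel_iff) (auto intro!: divide_left_mono)
  finally have "\<bar>of_int c * ?d\<bar> \<le> of_int \<bar>c\<bar> * (ln (real x / b) + 1)"
    by (simp add: abs_mult mult_left_mono)
  hence "of_int c * ?d \<ge> - (of_int \<bar>c\<bar> * (ln (real x / b) + 1))"
    using abs_le_D2 minus_le_iff by blast
  moreover have ln_xe: "ln (real x / e) = ln x - ln e"
    using e assms by (simp add: ln_div)
  have "of_int c * (real x / e * (ln (real x / e) - 1)) =
      x * (ln x - 1) * (of_int c / real e) - x * (of_int c * ln (real e) / real e)"
    unfolding ln_xe by (simp add: algebra_simps diff_divide_distrib add_divide_distrib)
  ultimately show ?case
    using Cons ec by (simp add: algebra_simps)
qed simp

section \<open>Crude bounds for primes and prime powers\<close>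

text \<open>A binomial coefficient is at most \<open>2 ^ n\<close>. For odd \<open>n\<close> the two
  halves differ by one, which accounts for \<open>ln n\<close>.\<close>

lemma ln_fact_central_le:
  assumes "n > 0"
  shows "ln (fact n :: real) - 2 * ln (fact (n div 2)) \<le> n * ln 2 + ln n"
proof -
  define k where "k = n div 2"
  have k: "k \<le> n" by (simp add: k_def)
  have "n - k = k \<or> n - k = Suc k" by (auto simp: k_def)
  hence "ln (fact (n - k) :: real) \<le> ln n + ln (fact k)"
  proof
    assume *: "n - k = Suc k"
    hence "ln (real (Suc k)) \<le> ln n" using assms by (subst ln_le_cancel_iff) auto
    with * show ?thesis by (simp add: ln_mult)
  qed (use assms in simp)
  moreover have "(fact n :: real) = fact k * fact (n - k) * (n choose k)"
    using binomial_fact_lemma[OF k] by (metis of_nat_fact of_nat_mult)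
  hence "ln (fact n :: real) = ln (fact k) + ln (fact (n - k)) + ln (real (n choose k))"
    using k by (simp add: ln_mult)
  moreover have "ln (real (n choose k)) \<le> ln (2 ^ n)"
    using k of_nat_mono[OF binomial_le_pow2[of n k], where 'a = real]
    by (subst ln_le_cancel_iff) auto
  hence "ln (real (n choose k)) \<le> n * ln 2" by (simp add: ln_realpow)
  ultimately show ?thesis unfolding k_def by linarith
qed

lemma sum_mangoldt_le: "(\<Sum>m=1..n. mangoldt m) \<le> 3 * real n"
proof (induction n rule: less_induct)
  case (less n)
  show ?case
  proof (cases "n = 0")
    case False
    define k where "k = n div 2"
    have "k < n" using False by (simp add: k_def)
    have "(\<Sum>m=1..n. mangoldt m) = (\<Sum>m=1..k. mangoldt m) + (\<Sum>m=Suc k..n. mangoldt m :: real)"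
      using \<open>k < n\<close> sum.ub_add_nat[of 1 k "mangoldt :: nat \<Rightarrow> real" "n - k"] by simp
    \<comment> \<open>The weight on the right is the parity of \<open>n div m\<close>: never
      negative, and 1 on the upper half, where \<open>n div m = 1\<close>.\<close>
    also have "(\<Sum>m=Suc k..n. mangoldt m :: real) \<le>
        (\<Sum>m=1..n. mangoldt m * (real (n div m) - 2 * real (n div m div 2)))"
    proof -
      have eq: "real i - 2 * real (i div 2) = real (i mod 2)" for i
        by (subst (1) mult_div_mod_eq[of 2 i, symmetric]) (simp only: of_nat_add of_nat_mult of_nat_numeral add_diff_cancel_left')
      have "n div m = 1" if "m \<in> {Suc k..n}" for m
      proof (rule div_nat_eqI)
        show "n < m * Suc 1" using that unfolding k_def by auto
      qed (use that in auto)
      hence "(\<Sum>m=Suc k..n. mangoldt m :: real) = (\<Sum>m=Suc k..n. mangoldt m * real (n div m mod 2))"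
        by (intro sum.cong) auto
      also have "\<dots> \<le> (\<Sum>m=1..n. mangoldt m * real (n div m mod 2))"
        by (intro sum_mono2) (auto intro: mult_nonneg_nonneg mangoldt_nonneg)
      finally show ?thesis unfolding eq .
    qed
    also have "\<dots> = ln (fact n) - 2 * ln (fact k)"
      unfolding k_def ln_fact_conv_mangoldt[of n]
      by (subst ln_fact_div_conv_mangoldt)
         (simp_all add: sum_subtractf sum_distrib_left algebra_simps del: of_nat_div)
    also have "\<dots> \<le> n * ln 2 + ln n"
      unfolding k_def by (rule ln_fact_central_le) (use False in simp)
    also have "(\<Sum>m=1..k. mangoldt m) \<le> 3 * real k"
      by (rule less.IH) fact
    also have "real k \<le> n / 2" unfolding k_def using of_nat_div_le_of_nat[of n 2] by simp
    also have ln2: "ln 2 \<le> (1::real)" using ln_le_minus_one[of 2] by simp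
    also have "ln n \<le> real n / 2"
    proof -
      have "ln (real n / 2) \<le> real n / 2 - 1" using False by (intro ln_le_minus_one) auto
      thus ?thesis using ln2 False by (simp add: ln_div)
    qed
    finally show ?thesis using False by simp
  qed simp
qed

text \<open>Distinct powers of one prime differ by a factor of at least 2, so the interval contains
  at most one power of each. A proper power has its base at most \<open>sqrt N\<close>, which bounds
  both the number of terms and each \<open>mangoldt\<close> value.\<close>

lemma sum_mangoldt_nonprime_le:
  fixes a N :: nat
  assumes "N \<le> 2 * a"
  shows "(\<Sum>m | m \<in> {a<..N} \<and> \<not> prime m. mangoldt m) \<le> sqrt N * (ln N / 2)"
proof -
  define A where "A = {m \<in> {a<..N}. primepow m \<and> \<not> prime m}"
  have A: "\<exists>p k. prime p \<and> k \<ge> 2 \<and> m = p ^ k \<and> aprimedivisor m = p" if "m \<in> A" for m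
  proof -
    from that obtain p k where pk: "prime p" "k > 0" "m = p ^ k" and "\<not> prime m"
      by (auto simp: A_def primepow_def)
    with pk have "k \<noteq> 1" by auto
    with pk show ?thesis
      by (intro exI[of _ p] exI[of _ k]) (auto simp: aprimedivisor_prime_power)
  qed
  have sq: "aprimedivisor m ^ 2 \<le> N \<and> aprimedivisor m > 0" if m: "m \<in> A" for m
  proof -
    obtain p k where pk: "prime p" "k \<ge> 2" "m = p ^ k" "aprimedivisor m = p"
      using A[OF m] by blast
    have "p ^ 2 \<le> p ^ k" using pk prime_ge_1_nat by (intro power_increasing) auto
    also have "\<dots> \<le> N" using m pk by (auto simp: A_def)
    finally show ?thesis using pk by (simp add: prime_gt_0_nat)
  qed
  have inj: "inj_on aprimedivisor A"
  proof (rule linorder_inj_onI')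
    fix m m' assume mm: "m \<in> A" "m' \<in> A" "m < m'"
    show "aprimedivisor m \<noteq> aprimedivisor m'"
    proof
      assume eq: "aprimedivisor m = aprimedivisor m'"
      obtain p k k' where p: "prime p" and "m = p ^ k" "m' = p ^ k'"
        using A[OF mm(1)] A[OF mm(2)] eq by metis
      with mm(3) have "k < k'" using power_less_imp_less_exp prime_gt_1_nat by blast
      hence "p ^ Suc k \<le> p ^ k'" using p prime_ge_1_nat by (intro power_increasing) auto
      moreover have "2 * p ^ k \<le> p ^ Suc k" using prime_ge_2_nat[OF p] by simp
      ultimately have "2 * m \<le> m'" using \<open>m = p ^ k\<close> \<open>m' = p ^ k'\<close> by linarith
      thus False using mm assms by (auto simp: A_def)
    qed
  qed
  have "aprimedivisor ` A \<subseteq> {1..nat \<lfloor>sqrt N\<rfloor>}"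
  proof
    fix p assume "p \<in> aprimedivisor ` A"
    hence "p ^ 2 \<le> N" "p > 0" using sq by auto
    hence "real p \<le> sqrt N"
      by (intro real_le_rsqrt) (metis of_nat_le_iff of_nat_power)
    thus "p \<in> {1..nat \<lfloor>sqrt N\<rfloor>}" using \<open>p > 0\<close> by (auto simp: le_nat_floor)
  qed
  hence "card A \<le> nat \<lfloor>sqrt N\<rfloor>"
    using inj card_inj_on_le[of aprimedivisor A "{1..nat \<lfloor>sqrt N\<rfloor>}"] by simp
  hence card: "real (card A) \<le> sqrt N"
    by (metis of_nat_floor of_nat_le_iff order_trans real_sqrt_ge_zero of_nat_0_le_iff)
  have le: "mangoldt m \<le> ln N / 2" if "m \<in> A" for m
  proof -
    have p: "aprimedivisor m > 0" "aprimedivisor m ^ 2 \<le> N" using sq[OF that] by auto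
    from of_nat_mono[OF this(2), where 'a = real]
    have "ln (real (aprimedivisor m) ^ 2) \<le> ln N"
      using p(1) by (intro ln_mono) simp_all
    thus ?thesis using that p by (simp add: A_def mangoldt_def ln_realpow)
  qed
  have "(\<Sum>m | m \<in> {a<..N} \<and> \<not> prime m. mangoldt m :: real) = (\<Sum>m\<in>A. mangoldt m)"
    by (intro sum.mono_neutral_right) (auto simp: A_def mangoldt_def)
  also have "\<dots> \<le> (\<Sum>m\<in>A. ln N / 2)"
    by (intro sum_mono le)
  also have "\<dots> = real (card A) * (ln N / 2)" by simp
  also have "\<dots> \<le> sqrt N * (ln N / 2)"
    using card by (cases "N = 0") (auto intro!: mult_right_mono)
  finally show ?thesis .
qed

section \<open>A combination of factorials isolating the interval\<close>

text \<open>
  The coefficients come from a linear program: under the above constraints on \<open>W\<close>,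
  maximise the leading constant \<open>- \<Sum>c\<^sub>e ln e / e\<close> of the sum of logarithms of factorials.
\<close>

definition coeffs67 :: "(nat \<times> int) list" where
  "coeffs67 =
     [(6, 1), (7, -1), (12, -1), (14, 1), (18, -1), (21, 1), (30, -1), (35, 1), (36, 1),
      (42, -2), (60, 1), (70, -1), (84, 1), (90, 1), (105, -2), (126, 2), (180, -2), (210, 2),
      (252, -2), (315, 2), (630, -2), (1260, 6)]"

text \<open>The weight is spelled out over \<open>int\<close> with literal divisors so that
  evaluation over one full period decides it.\<close>

lemma div_weight_coeffs67_check:
  "list_all (\<lambda>k::int.
      k div 6 - k div 7 - k div 12 + k div 14 - k div 18 + k div 21 - k div 30 + k div 35
      + k div 36 - 2 * (k div 42) + k div 60 - k div 70 + k div 84 + k div 90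
      - 2 * (k div 105) + 2 * (k div 126) - 2 * (k div 180) + 2 * (k div 210)
      - 2 * (k div 252) + 2 * (k div 315) - 2 * (k div 630) + 6 * (k div 1260)
      \<le> (if k = 6 then 1 else 0)) [0..1259]"
  by code_simp

lemma div_weight_coeffs67_le_one: "div_weight coeffs67 k \<le> 1"
  and div_weight_coeffs67_nonpos: "k < 1260 \<Longrightarrow> k \<noteq> 6 \<Longrightarrow> div_weight coeffs67 k \<le> 0"
proof -
  have le: "div_weight coeffs67 r \<le> (if r = 6 then 1 else 0)" if "r < 1260" for r
  proof -
    have "int r \<in> set [0..1259]" using that by simp
    from bspec[OF div_weight_coeffs67_check[unfolded list_all_iff] this]
    show ?thesis
      by (simp add: div_weight_def coeffs67_def zdiv_int split: if_splits)
  qed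
  show "k < 1260 \<Longrightarrow> k \<noteq> 6 \<Longrightarrow> div_weight coeffs67 k \<le> 0"
    using le[of k] by simp
  have "div_weight coeffs67 (k mod 1260) = div_weight coeffs67 k"
    by (rule div_weight_periodic) (simp_all add: coeffs67_def)
  with le[of "k mod 1260"] show "div_weight coeffs67 k \<le> 1"
    by (auto split: if_splits)
qed

lemma sum_coeffs67_ln:
  "(\<Sum>(e, c)\<leftarrow>coeffs67. of_int c * ln (real e) / real e) \<le> - 1 / 189"
proof -
  have lns:
    "ln (6::real) = ln 2 + ln 3" "ln (12::real) = ln 2 + ln 6" "ln (14::real) = ln 2 + ln 7"
    "ln (18::real) = ln 3 + ln 6" "ln (21::real) = ln 3 + ln 7"
    "ln (30::real) = ln 5 + ln 6" "ln (35::real) = ln 5 + ln 7"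
    "ln (36::real) = ln 2 + ln 18" "ln (42::real) = ln 2 + ln 21"
    "ln (60::real) = ln 2 + ln 30" "ln (70::real) = ln 2 + ln 35"
    "ln (84::real) = ln 2 + ln 42" "ln (90::real) = ln 3 + ln 30"
    "ln (105::real) = ln 3 + ln 35" "ln (126::real) = ln 3 + ln 42"
    "ln (180::real) = ln 2 + ln 90" "ln (210::real) = ln 2 + ln 105"
    "ln (252::real) = ln 2 + ln 126" "ln (315::real) = ln 3 + ln 105"
    "ln (630::real) = ln 2 + ln 315" "ln (1260::real) = ln 2 + ln 630"
    using ln_mult[of 2 "3::real"] ln_mult[of 2 "6::real"] ln_mult[of 2 "7::real"]
    ln_mult[of 3 "6::real"] ln_mult[of 3 "7::real"] ln_mult[of 5 "6::real"]
    ln_mult[of 5 "7::real"] ln_mult[of 2 "18::real"] ln_mult[of 2 "21::real"]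
    ln_mult[of 2 "30::real"] ln_mult[of 2 "35::real"] ln_mult[of 2 "42::real"]
    ln_mult[of 3 "30::real"] ln_mult[of 3 "35::real"] ln_mult[of 3 "42::real"]
    ln_mult[of 2 "90::real"] ln_mult[of 2 "105::real"] ln_mult[of 2 "126::real"]
    ln_mult[of 3 "105::real"] ln_mult[of 2 "315::real"] ln_mult[of 2 "630::real"]
    by simp_all
  \<comment> \<open>The exponents are those of the exact sum below, except that 2 has 58 in place of
    48. The spare 10 ln 2 is at least 20/3, and 20/3 divided by 1260 is 1/189.\<close>
  have "ln (2 ^ 58 * 3 ^ 57 :: real) \<le> ln (5 ^ 5 * 7 ^ 49)"
    by (subst ln_le_cancel_iff) simp_all
  hence "58 * ln 2 + 57 * ln 3 \<le> 5 * ln 5 + 49 * ln (7::real)"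
    by (simp only: ln_mult ln_realpow zero_less_power zero_less_numeral of_nat_numeral
        power_not_zero zero_neq_numeral if_True simp_thms)
  moreover have "(\<Sum>(e, c)\<leftarrow>coeffs67. of_int c * ln (real e) / real e) =
      (48 * ln 2 + 57 * ln 3 - 5 * ln 5 - 49 * ln 7) / 1260"
    by (simp add: coeffs67_def lns field_simps)
  ultimately show ?thesis
    using ln2_ge_two_thirds by simp
qed

lemma sum_mangoldt_interval_ge:
  assumes "n \<ge> 30"
  shows "(\<Sum>m\<in>{6*n<..7*n}. mangoldt m) \<ge> 11 / 90 * real n - 35 * (ln (7 * real n) + 1)"
proof -
  define x where "x = 42 * n"
  have "(\<Sum>(e, c)\<leftarrow>coeffs67. of_int c / real e) = 0"
    and "(\<Sum>(e, c)\<leftarrow>coeffs67. real_of_int \<bar>c\<bar>) = 35"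
    by (simp_all add: coeffs67_def)
  moreover have "x * (\<Sum>(e, c)\<leftarrow>coeffs67. of_int c * ln (real e) / real e) \<le> x * (- 1 / 189)"
    by (intro mult_left_mono sum_coeffs67_ln) simp
  ultimately have "x / 189 - 35 * (ln (real x / real 6) + 1) \<le>
      x * (ln x - 1) * (\<Sum>(e, c)\<leftarrow>coeffs67. of_int c / real e)
      - x * (\<Sum>(e, c)\<leftarrow>coeffs67. of_int c * ln (real e) / real e)
      - (\<Sum>(e, c)\<leftarrow>coeffs67. of_int \<bar>c\<bar>) * (ln (real x / real 6) + 1)"
    by simp
  also have "\<dots> \<le> (\<Sum>(e, c)\<leftarrow>coeffs67. of_int c * ln (fact (x div e)))"
    by (rule sum_ln_fact_ge) (use assms in \<open>auto simp: coeffs67_def x_def\<close>)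
  also have "\<dots> = (\<Sum>m=1..x. mangoldt m * real_of_int (div_weight coeffs67 (x div m)))"
    by (rule sum_ln_fact_conv_div_weight)
  also have "\<dots> \<le> (\<Sum>m=1..x. (if m \<in> {6*n<..7*n} then mangoldt m else 0) +
      (if m \<in> {1..n div 30} then mangoldt m else 0))"
  proof (rule sum_mono)
    fix m assume m: "m \<in> {1..x}"
    show "mangoldt m * real_of_int (div_weight coeffs67 (x div m)) \<le>
        (if m \<in> {6*n<..7*n} then mangoldt m else 0) + (if m \<in> {1..n div 30} then mangoldt m else 0)"
    proof (cases "m \<in> {6*n<..7*n} \<or> m \<in> {1..n div 30}")
      case True
      have "mangoldt m * real_of_int (div_weight coeffs67 (x div m)) \<le> mangoldt m * 1"
        using div_weight_coeffs67_le_one[of "x div m"]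
        by (intro mult_left_mono) (auto simp: mangoldt_nonneg)
      with True show ?thesis by (auto simp: mangoldt_nonneg intro: order_trans)
    next
      case False
      \<comment> \<open>A quotient of 1260 or more would put \<open>m\<close> in the tail, since
        1260 / 42 = 30.\<close>
      have "x div m < 1260"
      proof (rule ccontr)
        assume "\<not> x div m < 1260"
        hence "1260 * m \<le> x" using m by (simp add: less_eq_div_iff_mult_less_eq not_less)
        thus False using False m by (auto simp: x_def)
      qed
      moreover have "x div m \<noteq> 6"
      proof
        assume "x div m = 6"
        hence "6 * m \<le> x" "x < 7 * m"
          using m div_times_less_eq_dividend[of x m] dividend_less_div_times[of m x] by auto
        thus False using False by (auto simp: x_def)
      qed
      ultimately have "mangoldt m * real_of_int (div_weight coeffs67 (x div m)) \<le> 0"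
        using div_weight_coeffs67_nonpos[of "x div m"]
        by (intro mult_nonneg_nonpos) (auto simp: mangoldt_nonneg)
      thus ?thesis using False by auto
    qed
  qed
  also have "\<dots> = (\<Sum>m\<in>{6*n<..7*n}. mangoldt m) + (\<Sum>m=1..n div 30. mangoldt m)"
  proof -
    have "{1..x} \<inter> {6*n<..7*n} = {6*n<..7*n}" "{1..x} \<inter> {1..n div 30} = {1..n div 30}"
      by (auto simp: x_def)
    thus ?thesis by (simp only: sum.distrib flip: sum.inter_restrict[OF finite_atLeastAtMost])
  qed
  also have "(\<Sum>m=1..n div 30. mangoldt m) \<le> 3 * real (n div 30)"
    by (rule sum_mangoldt_le)
  also have "real (n div 30) \<le> real n / 30"
    using of_nat_div_le_of_nat[of n 30] by simp
  \<comment> \<open>The constant is 42/189 - 3/30 = 11/90.\<close>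
  finally show ?thesis by (simp add: x_def algebra_simps)
qed

section \<open>Large and small arguments\<close>

lemma exists_prime_67_large:
  fixes n :: nat
  assumes "n \<ge> 2 ^ 15"
  shows "\<exists>p. prime p \<and> 6 * n < p \<and> p \<le> 7 * n"
proof (rule ccontr)
  assume no_prime: "\<nexists>p. prime p \<and> 6 * n < p \<and> p \<le> 7 * n"
  define s where "s = sqrt (7 * real n)"
  have s2: "s * s = 7 * real n" by (simp add: s_def)
  have n: "real n \<ge> 32768" using assms by simp
  \<comment> \<open>Here 478 is the integer part of the square root of 7 * 32768.\<close>
  have "478 \<le> s" unfolding s_def using n by (intro real_le_rsqrt) simp
  hence "s > 0" by simp
  have ln_n: "ln (7 * real n) = 2 * ln s"
    using \<open>s > 0\<close> by (simp flip: s2 add: ln_mult)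
  have "{m. m \<in> {6*n<..7*n} \<and> \<not> prime m} = {6*n<..7*n}" using no_prime by auto
  hence "(\<Sum>m\<in>{6*n<..7*n}. mangoldt m) \<le> s * ln s"
    using sum_mangoldt_nonprime_le[of "7 * n" "6 * n"] ln_n
    by (simp add: s_def del: greaterThanAtMost_iff)
  with sum_mangoldt_interval_ge[of n] n ln_n
  have "11 / 90 * real n \<le> s * ln s + 70 * ln s + 35" by simp
  hence "11 / 630 * (s * s) \<le> (s + 70) * ln s + 35" by (simp add: s2 algebra_simps)
  \<comment> \<open>The tangent to the logarithm at 512, a power of two close to the least
    admissible \<open>s\<close>; 21/4 is 9 * 25/36 - 1.\<close>
  also have "ln s \<le> s / 512 + 21 / 4"
  proof -
    have "ln (s / 2 ^ 9) \<le> s / 2 ^ 9 - 1"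
      using \<open>s > 0\<close> by (intro ln_le_minus_one) simp
    moreover have "ln (s / 2 ^ 9) = ln s - 9 * ln 2"
      using \<open>s > 0\<close> by (simp only: ln_div ln_realpow zero_less_power zero_less_numeral) simp
    ultimately show ?thesis using ln2_le_25_over_36 by simp
  qed
  finally have "11 / 630 * (s * s) \<le> (s + 70) * (s / 512 + 21 / 4) + 35"
    using \<open>s > 0\<close> by simp
  also have "\<dots> = s * s / 512 + 2758 / 512 * s + 805 / 2"
    by (simp add: field_simps)
  finally have "11 / 630 * (s * s) \<le> s * s / 512 + 2758 / 512 * s + 805 / 2" .
  moreover have "s * s \<ge> 478 * s" using \<open>478 \<le> s\<close> by simp
  ultimately show False using \<open>478 \<le> s\<close> by linarith
qed

section \<open>Prime chains and primality by trial division\<close>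

fun prime_chain :: "nat \<Rightarrow> nat list \<Rightarrow> nat \<Rightarrow> bool" where
  "prime_chain a [] b \<longleftrightarrow> b \<le> a"
| "prime_chain a (p # ps) b \<longleftrightarrow> p < 7 * a \<and> prime_chain ((p - 1) div 6 + 1) ps b"

text \<open>The arguments from \<open>a\<close> on remain to be covered. As
  \<open>p < 7 * a\<close>, the prime \<open>p\<close> serves all of them with
  \<open>6 * n < p\<close>; the first one it misses is p/6 rounded up, that is
  \<open>(p - 1) div 6 + 1\<close>.\<close>

lemma prime_chain_covers:
  assumes "prime_chain a ps b" "\<forall>p\<in>set ps. prime p" "a \<le> n" "n < b"
  shows "\<exists>p. prime p \<and> 6 * n < p \<and> p < 7 * n"
  using assms
proof (induction ps arbitrary: a)
  case (Cons p ps)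
  show ?case
  proof (cases "6 * n < p")
    case True
    with Cons.prems show ?thesis by (intro exI[of _ p]) auto
  next
    case False
    with Cons show ?thesis
      using prime_gt_0_nat[of p] by (intro Cons.IH[of "(p - 1) div 6 + 1"]) auto
  qed
qed auto

function trial_division :: "int \<Rightarrow> int \<Rightarrow> bool" where
  "trial_division d p \<longleftrightarrow> (if d * d \<le> p then \<not> d dvd p \<and> trial_division (d + 2) p else True)"
  by auto
termination
proof (relation "measure (\<lambda>(d, p). nat (p + 1 - d))")
  fix d p :: int assume "d * d \<le> p"
  \<comment> \<open>Hence \<open>d \<le> p\<close> under the guard, for negative \<open>d\<close> as
    well, so the measure is positive and decreases.\<close>
  moreover have "d \<le> d * d" by (cases "d \<le> 0") (auto intro: order_trans[of d 0])
  ultimately show "((d + 2, p), (d, p)) \<in> measure (\<lambda>(d, p). nat (p + 1 - d))" by simp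
qed simp

declare trial_division.simps [simp del]

lemma trial_division_imp_not_dvd:
  assumes "trial_division d p" "d \<le> e" "even (e - d)" "0 \<le> d" "e * e \<le> p"
  shows "\<not> e dvd p"
  using assms
proof (induction d p rule: trial_division.induct)
  case (1 d p)
  have "d * d \<le> e * e" using 1 by (intro mult_mono) auto
  hence le: "d * d \<le> p" using 1 by simp
  with "1.prems" have "\<not> d dvd p" "trial_division (d + 2) p"
    by (simp_all add: trial_division.simps[of d p])
  show ?case
  proof (cases "e = d")
    case False
    with "1.prems" have "d + 2 \<le> e" by presburger
    with "1.prems" le \<open>trial_division (d + 2) p\<close> show ?thesis
      by (intro "1.IH") (auto simp: algebra_simps)
  qed (use \<open>\<not> d dvd p\<close> in simp)
qed

lemma prime_if_trial_division:
  assumes "trial_division 3 (int p)" "odd p" "1 < p"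
  shows "prime p"
proof (rule ccontr)
  assume "\<not> prime p"
  with assms(3) obtain q where "q dvd p" "q \<noteq> 1" "q \<noteq> p"
    by (auto simp: prime_nat_iff)
  then obtain r where "p = q * r" by (elim dvdE)
  with \<open>q \<noteq> 1\<close> \<open>q \<noteq> p\<close> assms(3) have qr: "p = q * r" "q > 1" "r > 1"
    by (cases q; cases r; auto)+
  \<comment> \<open>The smaller cofactor has square at most \<open>p\<close>; being odd and greater
    than 1, it is among the candidates 3, 5, 7, ...\<close>
  define e where "e = min q r"
  have "e dvd p" "e > 1" using qr by (auto simp: e_def min_def)
  moreover have "e * e \<le> p" unfolding e_def qr(1) by (intro mult_mono) auto
  moreover have "odd e" using \<open>e dvd p\<close> assms(2) by (meson dvd_trans)
  moreover from this \<open>e > 1\<close> have "e \<ge> 3" by (cases "e = 2") auto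
  ultimately show False
    using trial_division_imp_not_dvd[OF assms(1), of "int e"]
    by (simp flip: of_nat_mult)
qed

lemma exists_prime_67_small:
  fixes n :: nat
  assumes "n > 4" "n < 2 ^ 15"
  shows "\<exists>p. prime p \<and> 6 * n < p \<and> p < 7 * n"
proof (rule prime_chain_covers)
  let ?ps = "[31, 41, 47, 53, 61, 73, 89, 103, 113, 131, 151, 181, 211, 251, 293, 337, 397, 467, 541,
      631, 739, 863, 997, 1163, 1327, 1553, 1811, 2113, 2467, 2879, 3359, 3919, 4567, 5333,
      6221, 7253, 8461, 9871, 11519, 13421, 15649, 18257, 21283, 24821, 28949, 33773, 39397,
      45959, 53617, 62549, 72973, 85133, 99317, 115861, 135173, 157679, 183959, 214607] :: nat list"
  show "prime_chain 5 ?ps (2 ^ 15)" by simp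
  have "\<forall>p\<in>set ?ps. trial_division 3 (int p)"
    by (simp, code_simp)
  moreover have "\<forall>p\<in>set ?ps. odd p \<and> 1 < p" by simp
  ultimately show "\<forall>p\<in>set ?ps. prime p"
    using prime_if_trial_division by blast
qed (use assms in auto)

theorem corollary2p2p13:
  fixes n :: nat
  assumes "n > 4"
  shows "\<exists>p::nat. prime p \<and> 6 * n < p \<and> p < 7 * n"
proof (cases "n < 2 ^ 15")
  case True
  with assms show ?thesis by (rule exists_prime_67_small)
next
  case False
  then obtain p where p: "prime p" "6 * n < p" "p \<le> 7 * n"
    using exists_prime_67_large by (meson not_le)
  \<comment> \<open>The factorial argument yields an interval closed on the right; its endpoint
    \<open>7 * n\<close> is composite.\<close>
  have "p \<noteq> 7 * n" using p(1) assms prime_product[of 7 n] by auto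
  with p show ?thesis by auto
qed

end
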